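(* Let $\mathcal{A}\in T_{m,n}$, $q\in\mathbb{R}^n$ and $v^{(0)}\in\mathcal{F}_1$, and let $H$ be the homotopy function defined in the context. If the homotopy curve $\Gamma_{v^{(0)}}$ is smooth, then the positive predictor direction $\tau^{(0)}$ at the initial point $v^{(0)}$ satisfies $$\operatorname{sign}\left(\det\begin{bmatrix}\dfrac{\partial H}{\partial (v,\mu)}(v^{(0)},v^{(0)},1)\\[2mm] (\tau^{(0)})^{T}\end{bmatrix}\right)<0 .$$
   Context: $T_{m,n}$ is the set of real tensors $\mathcal{A}=(a_{i_1i_2\cdots i_m})$ of order $m$ and dimension $n$, with $i_j\in\{1,\dots,n\}$ (with $m\ge 2$, so that the expressions below make sense). For $x\in\mathbb{R}^n$, $\mathcal{A}x^{m-2}\in\mathbb{R}^{n\times n}$ is the matrix with entries $(\mathcal{A}x^{m-2})_{ij}=\sum_{i_3,\dots,i_m=1}^n a_{iji_3\cdots i_m}x_{i_3}\cdots x_{i_m}$, and $\mathcal{A}x^{m-1}\in\mathbb{R}^n$ is the vector with entries $(\mathcal{A}x^{m-1})_i=\sum_{i_2,\dots,i_m=1}^n a_{ii_2\cdots i_m}x_{i_2}\cdots x_{i_m}$. The partially symmetrized tensor $\hat{\mathcal{A}}$ of $\mathcal{A}$ has entries $\hat a_{i_1i_2\cdots i_m}=\frac{1}{(m-1)!}\sum_\pi a_{i_1\pi(i_2\cdots i_m)}$, the sum being over all permutations $\pi(i_2\cdots i_m)$ of the indices $i_2,\dots,i_m$. $\mathcal{F}_1=\{(x,w,z_1,z_2)\in(\mathbb{R}^n)^4: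 x>0,\,w>0,\,z_1>0,\,z_2>0\}$ (componentwise inequalities). Write $v=(x,w,z_1,z_2)$ and $v^{(0)}=(x^{(0)},w^{(0)},z_1^{(0)},z_2^{(0)})\in\mathcal{F}_1$, and $X=\mathrm{diag}(x)$, $Z_j=\mathrm{diag}(z_j)$, $Z_j^{(0)}=\mathrm{diag}(z_j^{(0)})$ for $j=1,2$. The homotopy function is $$H(v,v^{(0)},\mu)=\begin{bmatrix}(1-\mu)\big(w-z_1+(m-1)(\hat{\mathcal{A}}x^{m-2})^T(x-z_2)\big)+\mu(x-x^{(0)})\\ Z_1x-\mu Z_1^{(0)}x^{(0)}\\ Z_2w-\mu Z_2^{(0)}w^{(0)}+(1-\mu)Xw\\ w-(1-\mu)(\mathcal{A}x^{m-1}+q)-\mu w^{(0)}\end{bmatrix},\qquad \mu\in(0,1].$$ $\Gamma_{v^{(0)}}$ is the curve starting from $(v^{(0)},1)$ in the zero set $\{(v,\mu)\in\mathcal{F}_1\times(0,1]: H(v,v^{(0)},\mu)=0\}$. $\frac{\partial H}{\partial(v,\mu)}=\begin{bmatrix}\frac{\partial H}{\partial v}&\frac{\partial H}{\partial\mu}\end{bmatrix}$ is the $4n\times(4n+1)$ Jacobian of $H$ with respect to $(v,\mu)$ with $v^{(0)}$ held fixed, the columns being ordered as $x,w,z_1,z_2,\mu$. The positive predictor direction at the initial point is $$\tau^{(0)}=\frac{1}{n_0}\begin{bmatrix}s^{(0)}\\-1\end{bmatrix}\in\mathbb{R}^{4n+1},\quad s^{(0)}=\Big(\frac{\partial H}{\partial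 v}(v^{(0)},v^{(0)},1)\Big)^{-1}\frac{\partial H}{\partial\mu}(v^{(0)},v^{(0)},1),\quad n_0=\left\|\begin{bmatrix}s^{(0)}\\-1\end{bmatrix}\right\| .$$ *)

theory Defs
  imports "HOL-Analysis.Analysis" "HOL-Combinatorics.Permutations" "HOL-Library.FuncSet"
begin

section \<open>Tensors\<close>

text \<open>
  A real tensor of order \<open>m\<close> and dimension \<open>CARD('n)\<close> is a function on the multi-indices
  \<open>[i\<^sub>1, \<dots>, i\<^sub>m]\<close>, i.e. on the lists of length \<open>m\<close> over \<open>'n\<close>; it is \<open>undefined\<close> on all other lists.
\<close>

definition tensors :: "nat \<Rightarrow> ('n::finite list \<Rightarrow> real) set" where
  "tensors m = {is. length is = m} \<rightarrow>\<^sub>E UNIV"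

definition tensor_vec :: "nat \<Rightarrow> ('n::finite list \<Rightarrow> real) \<Rightarrow> real^'n \<Rightarrow> real^'n" where
  "tensor_vec m A x =
     (\<chi> i. \<Sum>is | length is = m - 1. A (i # is) * prod_list (map (\<lambda>k. x $ k) is))"

definition tensor_mat :: "nat \<Rightarrow> ('n::finite list \<Rightarrow> real) \<Rightarrow> real^'n \<Rightarrow> real^'n^'n" where
  "tensor_mat m A x =
     (\<chi> i j. \<Sum>is | length is = m - 2. A (i # j # is) * prod_list (map (\<lambda>k. x $ k) is))"

text \<open>
  The symmetrization over \<open>i\<^sub>2, \<dots>, i\<^sub>m\<close> runs over all \<open>(m - 1)!\<close> permutations of the \<^emph>\<open>positions\<close>,
  so that coinciding indices are counted with multiplicity.
\<close>

definition partial_sym :: "nat \<Rightarrow> ('n::finite list \<Rightarrow> real) \<Rightarrow> 'n list \<Rightarrow> real" where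
  "partial_sym m A = (\<lambda>is \<in> {is. length is = m}.
     (\<Sum>p | p permutes {..<m - 1}. A (hd is # permute_list p (tl is))) / fact (m - 1))"

section \<open>Block vectors\<close>

text \<open>
  Block vectors and matrices are indexed by sum types. Since \<^const>\<open>det\<close> needs rows and columns
  indexed by the same type, the \<open>k\<close>-th block of rows and the \<open>k\<close>-th block of columns of a square
  block matrix carry the same indices; this fixes the sign of the determinant.
  Over the index type \<open>unit\<close>, \<open>vec \<mu>\<close> is the one-entry vector \<open>\<mu>\<close> and \<open>vec \<tau>\<close> is the matrix whose
  single row is \<open>\<tau>\<close>.
\<close>

definition vcat :: "'c^'a::finite \<Rightarrow> 'c^'b::finite \<Rightarrow> 'c^('a + 'b)" (infixr "\<frown>" 65) where
  "a \<frown> b = (\<chi> k. case k of Inl i \<Rightarrow> a $ i | Inr j \<Rightarrow> b $ j)"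

definition upper :: "'c^('a::finite + 'b::finite) \<Rightarrow> 'c^'a" where
  "upper v = (\<chi> i. v $ Inl i)"

definition lower :: "'c^('a::finite + 'b::finite) \<Rightarrow> 'c^'b" where
  "lower v = (\<chi> j. v $ Inr j)"

definition diag :: "real^'n::finite \<Rightarrow> real^'n^'n" where
  "diag x = (\<chi> i j. if i = j then x $ i else 0)"

text \<open>The space containing \<open>v = (x, w, z\<^sub>1, z\<^sub>2)\<close>, of dimension \<open>4 n\<close>.\<close>

type_synonym 'n four = "'n + 'n + 'n + 'n"

definition F1 :: "(real^'n::finite four) set" where
  "F1 = {x \<frown> w \<frown> z1 \<frown> z2 | x w z1 z2.
     (\<forall>i. 0 < x $ i) \<and> (\<forall>i. 0 < w $ i) \<and> (\<forall>i. 0 < z1 $ i) \<and> (\<forall>i. 0 < z2 $ i)}"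

section \<open>The homotopy\<close>

definition homotopy ::
  "nat \<Rightarrow> ('n::finite list \<Rightarrow> real) \<Rightarrow> real^'n \<Rightarrow> real^'n four \<Rightarrow> real^'n four \<Rightarrow> real \<Rightarrow> real^'n four"
where
  "homotopy m A q v v0 \<mu> =
    (let x = upper v; w = upper (lower v);
         z1 = upper (lower (lower v)); z2 = lower (lower (lower v));
         x0 = upper v0; w0 = upper (lower v0);
         z10 = upper (lower (lower v0)); z20 = lower (lower (lower v0))
     in ((1 - \<mu>) *\<^sub>R (w - z1
            + real (m - 1) *\<^sub>R (transpose (tensor_mat m (partial_sym m A) x) *v (x - z2)))
          + \<mu> *\<^sub>R (x - x0))
      \<frown> (diag z1 *v x - \<mu> *\<^sub>R (diag z10 *v x0))
      \<frown> (diag z2 *v w - \<mu> *\<^sub>R (diag z20 *v w0) + (1 - \<mu>) *\<^sub>R (diag x *v w))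
      \<frown> (w - (1 - \<mu>) *\<^sub>R (tensor_vec m A x + q) - \<mu> *\<^sub>R w0))"

definition zero_set ::
  "nat \<Rightarrow> ('n::finite list \<Rightarrow> real) \<Rightarrow> real^'n \<Rightarrow> real^'n four \<Rightarrow> ((real^'n four) \<times> real) set" where
  "zero_set m A q v0 = {(v, \<mu>). v \<in> F1 \<and> \<mu> \<in> {0<..1} \<and> homotopy m A q v v0 \<mu> = 0}"

text \<open>The branch of the zero set that starts from \<open>(v0, 1)\<close>.\<close>

definition homotopy_curve ::
  "nat \<Rightarrow> ('n::finite list \<Rightarrow> real) \<Rightarrow> real^'n \<Rightarrow> real^'n four \<Rightarrow> ((real^'n four) \<times> real) set" where
  "homotopy_curve m A q v0 = connected_component_set (zero_set m A q v0) (v0, 1)"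

text \<open>
  \<open>C\<close> is a smooth curve with starting point \<open>p\<close>: it is homeomorphic to a nondegenerate interval
  \<open>I\<close> with left endpoint \<open>0\<close> by a regular \<open>C\<^sup>1\<close> parametrization sending \<open>0\<close> to \<open>p\<close>. The
  derivatives are two-sided, which is no restriction at an endpoint of \<open>I\<close>, as \<open>g\<close> can be chosen
  freely outside \<open>I\<close>.
\<close>

definition smooth_curve_from :: "'a::real_normed_vector \<Rightarrow> 'a set \<Rightarrow> bool" where
  "smooth_curve_from p C \<longleftrightarrow>
    (\<exists>I g h. is_interval I \<and> 0 \<in> I \<and> I \<subseteq> {0..} \<and> I \<noteq> {0} \<and>
       homeomorphism I C g h \<and> g 0 = p \<and>
       g C1_differentiable_on I \<and> (\<forall>t\<in>I. vector_derivative g (at t) \<noteq> 0))"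

section \<open>The predictor direction\<close>

text \<open>
  The formula for the homotopy makes sense for all real \<open>\<mu>\<close>, so the derivatives at the boundary
  value \<open>\<mu> = 1\<close> can be taken two-sidedly. The last coordinate of \<open>real^('n four + unit)\<close> is \<open>\<mu>\<close>.
\<close>

definition homotopy_jacobian ::
  "nat \<Rightarrow> ('n::finite list \<Rightarrow> real) \<Rightarrow> real^'n \<Rightarrow> real^'n four \<Rightarrow> real^'n four \<Rightarrow> real
     \<Rightarrow> real^('n four + unit)^'n four" where
  "homotopy_jacobian m A q v v0 \<mu> =
     jacobian (\<lambda>u. homotopy m A q (upper u) v0 (lower u $ ())) (at (v \<frown> vec \<mu>))"

definition homotopy_dv ::
  "nat \<Rightarrow> ('n::finite list \<Rightarrow> real) \<Rightarrow> real^'n \<Rightarrow> real^'n four \<Rightarrow> real^'n four \<Rightarrow> real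
     \<Rightarrow> real^'n four^'n four" where
  "homotopy_dv m A q v v0 \<mu> = jacobian (\<lambda>v'. homotopy m A q v' v0 \<mu>) (at v)"

definition homotopy_dmu ::
  "nat \<Rightarrow> ('n::finite list \<Rightarrow> real) \<Rightarrow> real^'n \<Rightarrow> real^'n four \<Rightarrow> real^'n four \<Rightarrow> real \<Rightarrow> real^'n four"
where
  "homotopy_dmu m A q v v0 \<mu> = vector_derivative (\<lambda>\<nu>. homotopy m A q v v0 \<nu>) (at \<mu>)"

definition predictor ::
  "nat \<Rightarrow> ('n::finite list \<Rightarrow> real) \<Rightarrow> real^'n \<Rightarrow> real^'n four \<Rightarrow> real^('n four + unit)" where
  "predictor m A q v0 =
    (let s = matrix_inv (homotopy_dv m A q v0 v0 1) *v homotopy_dmu m A q v0 v0 1;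
         t = s \<frown> vec (-1)
     in (1 / norm t) *\<^sub>R t)"

end

theory Submission
  imports Defs
begin

text \<open>
  Write \<open>M\<close> and \<open>b\<close> for the derivatives of the homotopy with respect to \<open>v\<close> and \<open>\<mu>\<close> at the
  initial point. The homotopy is a polynomial map, so its Jacobian there is \<open>[M b]\<close>
  (\<open>jacobian_bordered\<close>, \<open>differentiable_homotopy\<close>), and the matrix in question is \<open>[M b]\<close> bordered
  below by \<open>(s, -1) / n\<^sub>0\<close> with \<open>M s = b\<close>. Clearing the column \<open>b\<close> by means of \<open>s\<close>
  (\<open>det_bordered\<close>) shows that its determinant is \<open>det M\<close> times \<open>(- 1 - s \<bullet> s) / n\<^sub>0\<close>,
  and the second factor is negative whatever \<open>b\<close> is.

  It remains to see that \<open>det M > 0\<close>. At \<open>\<mu> = 1\<close> everything that involves the tensor is multiplied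
  by \<open>1 - \<mu> = 0\<close>, and the block rows of \<open>M\<close> are \<open>(I, 0, 0, 0)\<close>, \<open>(Z\<^sub>1, 0, X, 0)\<close>,
  \<open>(0, Z\<^sub>2, 0, W)\<close> and \<open>(0, I, 0, 0)\<close>.
  Moving the last block row to the second place makes this lower triangular with diagonal blocks
  \<open>I, I, X, W\<close>. That move permutes three blocks of rows cyclically; a permutation whose cube is the
  identity is even, so the sign is \<open>1\<close> in every dimension. Hence \<open>det M\<close> is the product
  of the entries of \<open>x\<close> and \<open>w\<close> (\<open>det_homotopy_dv_at_one\<close>), which are positive.
\<close>

section \<open>Determinants of block matrices\<close>

lemma permutes_map_sum:
  fixes p :: "'a::finite \<Rightarrow> 'a" and q :: "'b::finite \<Rightarrow> 'b"
  assumes "p permutes UNIV" "q permutes UNIV"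
  shows "map_sum p q permutes UNIV"
proof -
  have "bij p" "bij q"
    using assms by (auto intro: permutes_bij)
  then have "inj (map_sum p q)"
    by (auto simp: inj_def bij_def map_sum_def split: sum.splits)
  then show ?thesis
    by (intro bij_imp_permutes) (auto simp: finite_UNIV_inj_surj bij_def)
qed

text \<open>
  A block-preserving permutation is the product of its two restrictions, each extended by the
  identity, and extending a permutation by fixed points does not change its sign.
\<close>

lemma sign_map_sum:
  fixes p :: "'a::finite \<Rightarrow> 'a" and q :: "'b::finite \<Rightarrow> 'b"
  assumes "p permutes UNIV" "q permutes UNIV"
  shows "sign (map_sum p q) = sign p * sign q"
proof -
  have l: "map_sum p (id :: 'b \<Rightarrow> 'b) = map_permutation UNIV Inl p"
    and r: "map_sum (id :: 'a \<Rightarrow> 'a) q = map_permutation UNIV Inr q"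
    by (auto simp: fun_eq_iff map_permutation_def restrict_id_def map_sum_def split: sum.splits)
  have "map_sum p q = map_sum p id \<circ> map_sum id q"
    by (simp add: map_sum.comp)
  moreover have "permutation (map_sum p (id :: 'b \<Rightarrow> 'b))" "permutation (map_sum (id :: 'a \<Rightarrow> 'a) q)"
    using assms by (auto intro!: permutes_imp_permutation[OF finite] permutes_map_sum permutes_id)
  ultimately have "sign (map_sum p q)
      = sign (map_sum p (id :: 'b \<Rightarrow> 'b)) * sign (map_sum (id :: 'a \<Rightarrow> 'a) q)"
    by (simp add: sign_compose)
  then show ?thesis
    using assms by (simp add: l r sign_map_permutation)
qed

text \<open>
  By finiteness, a permutation that maps the first block into itself maps it onto itself, so
  injectivity forces the second block to be preserved as well.
\<close>

lemma permutes_block_decompose: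
  fixes p :: "'a::finite + 'b::finite \<Rightarrow> 'a + 'b"
  assumes p: "p permutes UNIV" and l: "\<And>i. p (Inl i) \<in> range Inl"
  obtains p1 p2 where "p1 permutes UNIV" "p2 permutes UNIV" "p = map_sum p1 p2"
proof -
  have inj: "inj p"
    using p by (rule permutes_inj)
  have "p ` range Inl = range Inl"
    using l inj by (intro endo_inj_surj) (auto intro: inj_on_subset)
  have r: "p (Inr j) \<in> range Inr" for j
  proof (cases "p (Inr j)")
    case (Inl i)
    then have "p (Inr j) \<in> p ` range Inl"
      using \<open>p ` range Inl = range Inl\<close> by simp
    then show ?thesis
      using inj by (auto dest: injD)
  qed simp
  have "\<exists>p1. \<forall>i. p (Inl i) = Inl (p1 i)" "\<exists>p2. \<forall>i. p (Inr i) = Inr (p2 i)"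
    using l r by (fast intro!: choice)+
  then obtain p1 p2 where p12: "\<And>i. p (Inl i) = Inl (p1 i)" "\<And>j. p (Inr j) = Inr (p2 j)"
    by blast
  have "inj p1" "inj p2"
    using inj by (metis injI injD p12 sum.inject)+
  then have "p1 permutes UNIV" "p2 permutes UNIV"
    by (auto intro!: bij_imp_permutes simp: finite_UNIV_inj_surj bij_def)
  moreover have "p = map_sum p1 p2"
  proof
    show "p k = map_sum p1 p2 k" for k
      by (cases k) (auto simp: p12)
  qed
  ultimately show thesis
    by (rule that)
qed

text \<open>
  In the Leibniz sum only the permutations that preserve the two blocks can contribute: any other
  one sends some row of the first block to a column of the second, where the entry vanishes. For
  the remaining ones, the sign and the product split, and the sum becomes a product of two
  Leibniz sums.
\<close>

lemma det_block_triangular: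
  fixes N :: "'c::comm_ring_1^('a::finite + 'b::finite)^('a + 'b)"
  assumes 0: "\<And>i j. N $ Inl i $ Inr j = 0"
  shows "det N = det (\<chi> i j. N $ Inl i $ Inl j) * det (\<chi> i j. N $ Inr i $ Inr j)"
proof -
  define f where "f p = of_int (sign p) * (\<Prod>k\<in>UNIV. N $ k $ p k)" for p
  define PA where "PA = {p :: 'a \<Rightarrow> 'a. p permutes UNIV}"
  define PB where "PB = {p :: 'b \<Rightarrow> 'b. p permutes UNIV}"
  have "det N = sum f {p. p permutes UNIV}"
    by (simp add: det_def f_def)
  also have "\<dots> = sum f ((\<lambda>(p, q). map_sum p q) ` (PA \<times> PB))"
  proof (rule sum.mono_neutral_right)
    show "(\<lambda>(p, q). map_sum p q) ` (PA \<times> PB) \<subseteq> {p. p permutes UNIV}"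
      by (auto simp: PA_def PB_def intro: permutes_map_sum)
    show "\<forall>p\<in>{p. p permutes UNIV} - (\<lambda>(p, q). map_sum p q) ` (PA \<times> PB). f p = 0"
    proof
      fix p :: "'a + 'b \<Rightarrow> 'a + 'b"
      assume p: "p \<in> {p. p permutes UNIV} - (\<lambda>(p, q). map_sum p q) ` (PA \<times> PB)"
      have "\<exists>i. p (Inl i) \<notin> range Inl"
      proof (rule ccontr)
        assume "\<nexists>i. p (Inl i) \<notin> range Inl"
        then obtain p1 p2 where "p1 permutes UNIV" "p2 permutes UNIV" "p = map_sum p1 p2"
          using p by (auto elim: permutes_block_decompose)
        with p show False
          by (force simp: PA_def PB_def)
      qed
      then obtain i j where "p (Inl i) = Inr j"
        by (metis rangeI sum.exhaust)
      then have "(\<Prod>k\<in>UNIV. N $ k $ p k) = 0"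
        by (intro prod_zero) (auto intro!: exI[of _ "Inl i"] simp: 0)
      then show "f p = 0"
        by (simp add: f_def)
    qed
  qed (simp add: finite_permutations)
  also have "\<dots> = (\<Sum>(p, q)\<in>PA \<times> PB. f (map_sum p q))"
  proof (subst sum.reindex)
    have "p = p'" "q = q'" if "map_sum p q = map_sum p' q'"
      for p p' :: "'a \<Rightarrow> 'a" and q q' :: "'b \<Rightarrow> 'b"
      using that by (auto simp: fun_eq_iff dest: spec[of _ "Inl _"] spec[of _ "Inr _"])
    then show "inj_on (\<lambda>(p, q). map_sum p q) (PA \<times> PB)"
      by (auto intro!: inj_onI)
  qed (simp add: case_prod_unfold)
  also have "\<dots> = (\<Sum>(p, q)\<in>PA \<times> PB.
      (of_int (sign p) * (\<Prod>i\<in>UNIV. N $ Inl i $ Inl (p i)))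
      * (of_int (sign q) * (\<Prod>j\<in>UNIV. N $ Inr j $ Inr (q j))))"
    by (intro sum.cong)
      (auto simp: f_def PA_def PB_def sign_map_sum UNIV_Plus_UNIV[symmetric] prod.Plus
         simp del: UNIV_Plus_UNIV)
  also have "\<dots> = det (\<chi> i j. N $ Inl i $ Inl j) * det (\<chi> i j. N $ Inr i $ Inr j)"
    by (simp add: det_def sum_product sum.cartesian_product PA_def PB_def)
  finally show ?thesis .
qed

lemma det_unit: "det (N :: 'c::comm_ring_1^unit^unit) = N $ () $ ()"
proof -
  have "det N = (\<Prod>i\<in>UNIV. N $ i $ i)"
    by (rule det_diagonal) auto
  then show ?thesis
    unfolding UNIV_unit by simp
qed

text \<open>
  The Schur complement formula. If the last column of the upper rows is the image \<open>M s\<close> of some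
  \<open>s\<close> under the square block \<open>M\<close>, then adding \<open>- s\<close> times the first block of columns to the last
  column clears it above the corner, and the corner becomes \<open>d - c \<bullet> s\<close>, where \<open>(c, d)\<close> is the
  bottom row. The vector \<open>s\<close> is a parameter, instead of \<open>M\<^sup>-\<^sup>1 b\<close>, so that the formula holds over any
  commutative ring.
\<close>

lemma det_bordered:
  fixes N :: "'c::comm_ring_1^('a::finite + unit)^('a + unit)"
  assumes s: "(\<chi> i j. N $ Inl i $ Inl j) *v s = (\<chi> i. N $ Inl i $ Inr ())"
  shows "det N = det (\<chi> i j. N $ Inl i $ Inl j)
    * (N $ Inr () $ Inr () - (\<Sum>j\<in>UNIV. N $ Inr () $ Inl j * s $ j))"
proof -
  \<comment> \<open>The column operation is recorded by the factorization \<open>N = L R\<close>, with \<open>R\<close> unipotent.\<close>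
  define L :: "'c^('a + unit)^('a + unit)" where
    "L = (\<chi> k. case k of Inl i \<Rightarrow> (\<chi> j. N $ Inl i $ Inl j) \<frown> 0
       | Inr _ \<Rightarrow> (\<chi> j. N $ Inr () $ Inl j)
           \<frown> vec (N $ Inr () $ Inr () - (\<Sum>j\<in>UNIV. N $ Inr () $ Inl j * s $ j)))"
  define R :: "'c^('a + unit)^('a + unit)" where
    "R = (\<chi> k. case k of Inl i \<Rightarrow> axis i 1 \<frown> vec (s $ i) | Inr _ \<Rightarrow> 0 \<frown> vec 1)"
  have sum: "(\<Sum>k\<in>UNIV. g k) = (\<Sum>i\<in>UNIV. g (Inl i)) + g (Inr ())" for g :: "'a + unit \<Rightarrow> 'c"
    unfolding UNIV_Plus_UNIV[symmetric] UNIV_unit by (subst sum.Plus) simp_all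
  have row: "(\<Sum>j\<in>UNIV. N $ Inl i $ Inl j * s $ j) = N $ Inl i $ Inr ()" for i
    using arg_cong[OF s, of "\<lambda>v. v $ i"] by (simp add: matrix_vector_mult_def)
  have "N $ k $ l = (L ** R) $ k $ l" for k l
    by (cases k; cases l)
      (simp_all add: matrix_matrix_mult_def sum L_def R_def vcat_def axis_def row
         if_distrib[of "(*) _"] cong: if_cong)
  then have "N = L ** R"
    by (simp add: vec_eq_iff)
  moreover have "det R = 1"
  proof -
    have "(\<chi> i j. transpose R $ Inl i $ Inl j) = (mat 1 :: 'c^'a^'a)"
      by (auto simp: R_def vcat_def transpose_def mat_def axis_def vec_eq_iff)
    moreover have "transpose R $ Inl i $ Inr j = 0" "transpose R $ Inr () $ Inr () = 1" for i j
      by (simp_all add: R_def vcat_def transpose_def)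
    ultimately have "det (transpose R) = 1"
      by (subst det_block_triangular) (simp_all add: det_unit)
    then show ?thesis
      unfolding det_transpose .
  qed
  moreover have "det L = det (\<chi> i j. N $ Inl i $ Inl j)
      * (N $ Inr () $ Inr () - (\<Sum>j\<in>UNIV. N $ Inr () $ Inl j * s $ j))"
    by (subst det_block_triangular) (auto simp: L_def vcat_def det_unit)
  ultimately show ?thesis
    by (simp add: det_mul)
qed

section \<open>Differentiation on block vectors\<close>

lemma bounded_linear_vcat_zero:
  shows "bounded_linear (\<lambda>h :: real^'a::finite. h \<frown> (0 :: real^'b::finite))"
    and "bounded_linear (\<lambda>h :: real^'b. (0 :: real^'a) \<frown> h)"
  by (auto simp: linear_conv_bounded_linear[symmetric] vcat_def vec_eq_iff
      intro!: linearI split: sum.splits)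

lemma bounded_linear_upper: "bounded_linear (upper :: real^('a::finite + 'b::finite) \<Rightarrow> real^'a)"
  and bounded_linear_lower: "bounded_linear (lower :: real^('a::finite + 'b::finite) \<Rightarrow> real^'b)"
  by (auto simp: linear_conv_bounded_linear[symmetric] upper_def lower_def vec_eq_iff
      intro!: linearI)

lemma upper_vcat [simp]: "upper (a \<frown> b) = a"
  and lower_vcat [simp]: "lower (a \<frown> b) = b"
  by (simp_all add: vcat_def upper_def lower_def vec_eq_iff)

lemma vcat_nth [simp]: "(a \<frown> b) $ Inl i = a $ i" "(a \<frown> b) $ Inr j = b $ j"
  by (simp_all add: vcat_def)

lemma has_derivative_vcat:
  fixes f :: "'a::real_normed_vector \<Rightarrow> real^'b::finite" and g :: "'a \<Rightarrow> real^'c::finite"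
  assumes "(f has_derivative f') F" "(g has_derivative g') F"
  shows "((\<lambda>u. f u \<frown> g u) has_derivative (\<lambda>h. f' h \<frown> g' h)) F"
proof -
  have split: "a \<frown> b = (a \<frown> 0) + (0 \<frown> b)" for a :: "real^'b" and b :: "real^'c"
    by (auto simp: vcat_def vec_eq_iff split: sum.splits)
  have "((\<lambda>u. (f u \<frown> 0) + (0 \<frown> g u)) has_derivative (\<lambda>h. (f' h \<frown> 0) + (0 \<frown> g' h))) F"
    by (intro has_derivative_add bounded_linear.has_derivative[OF bounded_linear_vcat_zero(1)]
        bounded_linear.has_derivative[OF bounded_linear_vcat_zero(2)] assms)
  then show ?thesis
    by (simp add: split[symmetric])
qed

lemma jacobian_nth:
  assumes "(f has_derivative f') (at a)"
  shows "jacobian f (at a) $ i $ j = f' (axis j 1) $ i"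
  using frechet_derivative_at[OF assms] by (simp add: jacobian_def matrix_def)

text \<open>
  The columns of the Jacobian in \<open>(v, \<mu>)\<close> are partial derivatives: both parts are the chain rule for
  the affine embeddings \<open>v' \<mapsto> (v', \<mu>)\<close> and \<open>\<nu> \<mapsto> (v, \<nu>)\<close>.
\<close>

lemma jacobian_bordered:
  fixes f :: "real^('a::finite + unit) \<Rightarrow> real^'b::finite"
  assumes f: "f differentiable (at (v \<frown> vec \<mu>))"
  shows "jacobian f (at (v \<frown> vec \<mu>)) $ i $ Inl j
      = jacobian (\<lambda>v'. f (v' \<frown> vec \<mu>)) (at v) $ i $ j"
    and "jacobian f (at (v \<frown> vec \<mu>)) $ i $ Inr ()
      = vector_derivative (\<lambda>\<nu>. f (v \<frown> vec \<nu>)) (at \<mu>) $ i"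
proof -
  obtain f' where f': "(f has_derivative f') (at (v \<frown> vec \<mu>))"
    using f by (auto simp: differentiable_def)
  have lin: "linear f'"
    using f' has_derivative_linear by blast
  have "((\<lambda>v'. f (v' \<frown> vec \<mu>)) has_derivative (\<lambda>h. f' (h \<frown> 0))) (at v)"
    by (rule has_derivative_compose[where f = "\<lambda>v'. v' \<frown> vec \<mu>", OF _ f'])
      (intro has_derivative_vcat has_derivative_ident has_derivative_const)
  moreover have "axis j 1 \<frown> 0 = (axis (Inl j) 1 :: real^('a + unit))"
    by (auto simp: vcat_def axis_def vec_eq_iff split: sum.splits)
  ultimately show "jacobian f (at (v \<frown> vec \<mu>)) $ i $ Inl j
      = jacobian (\<lambda>v'. f (v' \<frown> vec \<mu>)) (at v) $ i $ j"
    by (simp add: jacobian_nth[OF f'] jacobian_nth)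
  have "((\<lambda>\<nu>. vec \<nu> :: real^unit) has_derivative vec) (at \<mu>)"
    by (intro bounded_linear_imp_has_derivative) (simp add: linear_linear)
  then have "((\<lambda>\<nu>. f (v \<frown> vec \<nu>)) has_derivative (\<lambda>h. f' (0 \<frown> vec h))) (at \<mu>)"
    by (intro has_derivative_compose[where f = "\<lambda>\<nu>. v \<frown> vec \<nu>", OF _ f']
        has_derivative_vcat has_derivative_const)
  moreover have "0 \<frown> vec h = h *\<^sub>R (axis (Inr ()) 1 :: real^('a + unit))" for h
    by (auto simp: vcat_def axis_def vec_eq_iff split: sum.splits)
  ultimately have "((\<lambda>\<nu>. f (v \<frown> vec \<nu>)) has_vector_derivative f' (axis (Inr ()) 1)) (at \<mu>)"
    by (simp add: has_vector_derivative_def linear_cmul[OF lin])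
  then show "jacobian f (at (v \<frown> vec \<mu>)) $ i $ Inr ()
      = vector_derivative (\<lambda>\<nu>. f (v \<frown> vec \<nu>)) (at \<mu>) $ i"
    by (simp add: jacobian_nth[OF f'] vector_derivative_at)
qed

lemma differentiable_vec_nth:
  fixes f :: "'a::euclidean_space \<Rightarrow> real^'b::finite"
  shows "f differentiable (at a) \<longleftrightarrow> (\<forall>i. (\<lambda>u. f u $ i) differentiable (at a))"
  unfolding differentiable_componentwise_within[of f] by (simp add: Basis_vec_def inner_axis)

lemma differentiable_monomial:
  fixes x :: "'a::euclidean_space \<Rightarrow> real^'n::finite"
  assumes "x differentiable (at a)"
  shows "(\<lambda>u. prod_list (map (($) (x u)) ks)) differentiable (at a)"
  using assms by (induction ks) (simp_all add: differentiable_vec_nth)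

lemma diag_nth: "diag x $ i $ j = (if i = j then x $ i else 0)"
  by (simp add: diag_def)

lemma diag_mult_vec [simp]: "(diag x *v y) $ i = x $ i * y $ i"
  by (simp add: diag_nth matrix_vector_mult_def if_distrib[of "\<lambda>t. t * _"] cong: if_cong)

lemma has_derivative_diag_mult:
  fixes f g :: "'a::euclidean_space \<Rightarrow> real^'n::finite"
  assumes "(f has_derivative f') (at a)" "(g has_derivative g') (at a)"
  shows "((\<lambda>u. diag (f u) *v g u) has_derivative
    (\<lambda>h. diag (f a) *v g' h + diag (f' h) *v g a)) (at a)"
proof -
  have "bounded_bilinear (\<lambda>x y :: real^'n. diag x *v y)"
    by (auto simp: bilinear_conv_bounded_bilinear[symmetric] bilinear_def vec_eq_iff algebra_simps
        intro!: linearI)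
  from bounded_bilinear.FDERIV[OF this assms] show ?thesis .
qed

lemma differentiable_diag_mult:
  fixes f g :: "'a::euclidean_space \<Rightarrow> real^'n::finite"
  assumes "f differentiable (at a)" "g differentiable (at a)"
  shows "(\<lambda>u. diag (f u) *v g u) differentiable (at a)"
  using assms unfolding differentiable_def by (blast intro: has_derivative_diag_mult)

lemma differentiable_vcat:
  fixes f :: "'a::real_normed_vector \<Rightarrow> real^'b::finite" and g :: "'a \<Rightarrow> real^'c::finite"
  assumes "f differentiable F" "g differentiable F"
  shows "(\<lambda>u. f u \<frown> g u) differentiable F"
  using assms unfolding differentiable_def by (blast intro: has_derivative_vcat)

lemma
  fixes f :: "'a::real_normed_vector \<Rightarrow> real^('b::finite + 'c::finite)"
  assumes "f differentiable F"
  shows differentiable_upper: "(\<lambda>u. upper (f u)) differentiable F"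
    and differentiable_lower: "(\<lambda>u. lower (f u)) differentiable F"
  using assms unfolding differentiable_def
  by (blast intro: bounded_linear.has_derivative[OF bounded_linear_upper]
      bounded_linear.has_derivative[OF bounded_linear_lower])+

lemma differentiable_tensor_vec:
  fixes x :: "'a::euclidean_space \<Rightarrow> real^'n::finite"
  assumes "x differentiable (at a)"
  shows "(\<lambda>u. tensor_vec m A (x u)) differentiable (at a)"
  unfolding differentiable_vec_nth tensor_vec_def
  by (simp add: finite_list_length differentiable_monomial assms)

lemma differentiable_tensor_mat_mult:
  fixes x y :: "'a::euclidean_space \<Rightarrow> real^'n::finite"
  assumes "x differentiable (at a)" "y differentiable (at a)"
  shows "(\<lambda>u. transpose (tensor_mat m A (x u)) *v y u) differentiable (at a)"
proof -
  have "(\<lambda>u. y u $ i) differentiable (at a)" for i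
    using assms(2) by (simp add: differentiable_vec_nth)
  then show ?thesis
    unfolding differentiable_vec_nth matrix_vector_mult_def transpose_def tensor_mat_def
    by (simp add: finite_list_length differentiable_monomial assms)
qed

text \<open>
  The homotopy is polynomial in \<open>(v, \<mu>)\<close>, so joint differentiability holds everywhere; it is what
  allows the Jacobian at \<open>\<mu> = 1\<close> to be read off from the two partial derivatives.
\<close>

lemma differentiable_homotopy:
  fixes v0 :: "real^'n::finite four"
  shows "(\<lambda>u. homotopy m A q (upper u) v0 (lower u $ ())) differentiable (at a)"
proof -
  have "(\<lambda>u :: real^('n four + unit). lower u) differentiable (at a)"
    by (intro differentiable_lower differentiable_ident)
  then have "(\<lambda>u :: real^('n four + unit). lower u $ ()) differentiable (at a)"
    unfolding differentiable_vec_nth by blast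
  then show ?thesis
    unfolding homotopy_def Let_def
    by (intro differentiable_vcat differentiable_add differentiable_diff differentiable_scaleR
        differentiable_const differentiable_tensor_vec differentiable_tensor_mat_mult
        differentiable_diag_mult differentiable_upper differentiable_lower differentiable_ident)
qed

text \<open>
  At \<open>\<mu> = 1\<close> the factor \<open>1 - \<mu>\<close> removes the tensor, and \<open>q\<close>, from the homotopy as a function of
  \<open>v\<close>, which leaves \<open>(x - x\<^sub>0, Z\<^sub>1 x - c\<^sub>1, Z\<^sub>2 w - c\<^sub>2, w - w\<^sub>0)\<close>.
\<close>

lemma homotopy_dv_at_one:
  fixes x w z1 z2 :: "real^'n::finite"
  defines "v \<equiv> x \<frown> w \<frown> z1 \<frown> z2"
  shows "((\<lambda>v'. homotopy m A q v' v 1) has_derivative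
    (\<lambda>h. upper h
       \<frown> (diag z1 *v upper h + diag (upper (lower (lower h))) *v x)
       \<frown> (diag z2 *v upper (lower h) + diag (lower (lower (lower h))) *v w)
       \<frown> upper (lower h))) (at v)"
proof -
  have u: "((\<lambda>u. upper (f u)) has_derivative (\<lambda>h. upper (f' h))) F"
    and l: "((\<lambda>u. lower (f u)) has_derivative (\<lambda>h. lower (f' h))) F"
    if "(f has_derivative f') F"
    for F and f f' :: "'a::real_normed_vector \<Rightarrow> real^('b::finite + 'c::finite)"
    using that by (simp_all add: bounded_linear.has_derivative[OF bounded_linear_upper]
        bounded_linear.has_derivative[OF bounded_linear_lower])
  have d: "((\<lambda>u. f u - c) has_derivative f') F" if "(f has_derivative f') F"
    for F and f f' :: "'a::real_normed_vector \<Rightarrow> real^'n" and c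
    using has_derivative_diff[OF that has_derivative_const[of c]] by simp
  let ?G = "\<lambda>v'. (upper v' - x)
       \<frown> (diag (upper (lower (lower v'))) *v upper v' - diag z1 *v x)
       \<frown> (diag (lower (lower (lower v'))) *v upper (lower v') - diag z2 *v w)
       \<frown> (upper (lower v') - w)"
  have "(?G has_derivative
    (\<lambda>h. upper h
       \<frown> (diag (upper (lower (lower v))) *v upper h + diag (upper (lower (lower h))) *v upper v)
       \<frown> (diag (lower (lower (lower v))) *v upper (lower h)
            + diag (lower (lower (lower h))) *v upper (lower v))
       \<frown> upper (lower h))) (at v)"
    by (intro has_derivative_vcat d has_derivative_diag_mult u l has_derivative_ident)
  then show ?thesis
    by (simp add: homotopy_def Let_def v_def)
qed

section \<open>The sign at the initial point\<close>

text \<open>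
  The sign is a homomorphism into \<open>{1, -1}\<close>, where every element is its own cube. This settles the
  sign of a cyclic shift of three blocks without counting transpositions, whatever the block size.
\<close>

lemma sign_eq_1_if_cube_id:
  fixes p :: "'a::finite \<Rightarrow> 'a"
  assumes "p \<circ> p \<circ> p = id" and "p permutes UNIV"
  shows "sign p = 1"
proof -
  have "permutation p"
    using assms(2) by (rule permutes_imp_permutation[OF finite])
  then have "sign (p \<circ> p \<circ> p) = sign p"
    by (simp add: sign_compose permutation_compose)
  then show ?thesis
    by (simp add: assms(1))
qed

lemma det_diag: "det (diag x) = (\<Prod>i\<in>UNIV. x $ i)"
  by (subst det_diagonal) (simp_all add: diag_nth)

text \<open>
  Moving the fourth block row of the derivative to the second place leaves the rows
  \<open>(I, 0, 0, 0)\<close>, \<open>(0, I, 0, 0)\<close>, \<open>(Z\<^sub>1, 0, X, 0)\<close>, \<open>(0, Z\<^sub>2, 0, W)\<close>. The diagonal blocks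
  are then split off one at a time, since block vectors are nested to the right.
\<close>

lemma det_homotopy_dv_at_one:
  fixes x w z1 z2 :: "real^'n::finite"
  defines "v \<equiv> x \<frown> w \<frown> z1 \<frown> z2"
  shows "det (homotopy_dv m A q v v 1) = (\<Prod>i\<in>UNIV. x $ i) * (\<Prod>i\<in>UNIV. w $ i)"
proof -
  \<comment> \<open>New row to old row, on the last three blocks: the second place receives the fourth block.\<close>
  define \<rho> :: "'n + 'n + 'n \<Rightarrow> 'n + 'n + 'n" where
    "\<rho> = case_sum (Inr \<circ> Inr) (case_sum Inl (Inr \<circ> Inl))"
  define \<sigma> :: "'n four \<Rightarrow> 'n four" where "\<sigma> = map_sum id \<rho>"
  have cube: "\<rho> \<circ> \<rho> \<circ> \<rho> = id"
    by (auto simp: \<rho>_def fun_eq_iff split: sum.splits)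
  have "bij \<rho>"
    by (rule o_bij[of "\<rho> \<circ> \<rho>"]) (simp_all add: cube o_assoc)
  then have \<rho>: "\<rho> permutes UNIV"
    by (intro bij_imp_permutes) simp_all
  have \<sigma>: "\<sigma> permutes UNIV"
    unfolding \<sigma>_def by (intro permutes_map_sum permutes_id \<rho>)
  have "sign \<sigma> = 1"
    using sign_map_sum[OF permutes_id \<rho>] sign_eq_1_if_cube_id[OF cube \<rho>] by (simp add: \<sigma>_def)

  define N where "N = (\<chi> k. homotopy_dv m A q v v 1 $ \<sigma> k)"
  define N' where "N' = (\<chi> i j. N $ Inr i $ Inr j)"
  define N'' where "N'' = (\<chi> i j. N' $ Inr i $ Inr j)"
  have "det N = det (homotopy_dv m A q v v 1)"
    unfolding N_def by (simp add: det_permute_rows[OF \<sigma>] \<open>sign \<sigma> = 1\<close>)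
  have entry: "N $ k $ l = (upper (axis l 1)
       \<frown> (diag z1 *v upper (axis l 1) + diag (upper (lower (lower (axis l 1)))) *v x)
       \<frown> (diag z2 *v upper (lower (axis l 1)) + diag (lower (lower (lower (axis l 1)))) *v w)
       \<frown> upper (lower (axis l 1))) $ \<sigma> k" for k l
    unfolding N_def homotopy_dv_def v_def by (simp add: jacobian_nth[OF homotopy_dv_at_one])
  note entries = entry \<sigma>_def \<rho>_def upper_def lower_def axis_def

  have "det N = det (mat 1 :: real^'n^'n) * det N'"
  proof (subst det_block_triangular)
    have "(\<chi> i j. N $ Inl i $ Inl j) = (mat 1 :: real^'n^'n)"
      by (simp add: entries mat_def vec_eq_iff)
    then show "det (\<chi> i j. N $ Inl i $ Inl j) * det (\<chi> i j. N $ Inr i $ Inr j)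
        = det (mat 1 :: real^'n^'n) * det N'"
      by (simp add: N'_def)
  qed (simp add: entries)
  moreover have "det N' = det (mat 1 :: real^'n^'n) * det N''"
  proof (subst det_block_triangular)
    have "(\<chi> i j. N' $ Inl i $ Inl j) = (mat 1 :: real^'n^'n)"
      by (simp add: N'_def entries mat_def vec_eq_iff)
    then show "det (\<chi> i j. N' $ Inl i $ Inl j) * det (\<chi> i j. N' $ Inr i $ Inr j)
        = det (mat 1 :: real^'n^'n) * det N''"
      by (simp add: N''_def)
  qed (simp add: N'_def entries)
  moreover have "det N'' = det (diag x) * det (diag w)"
  proof (subst det_block_triangular)
    have "(\<chi> i j. N'' $ Inl i $ Inl j) = diag x" "(\<chi> i j. N'' $ Inr i $ Inr j) = diag w"
      by (simp_all add: N''_def N'_def entries diag_nth vec_eq_iff)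
    then show "det (\<chi> i j. N'' $ Inl i $ Inl j) * det (\<chi> i j. N'' $ Inr i $ Inr j)
        = det (diag x) * det (diag w)"
      by simp
  qed (simp add: N''_def N'_def entries)
  ultimately show ?thesis
    using \<open>det N = det (homotopy_dv m A q v v 1)\<close> by (simp add: det_diag)
qed

lemma homotopy_jacobian_columns:
  shows "homotopy_jacobian m A q v v0 \<mu> $ i $ Inl j = homotopy_dv m A q v v0 \<mu> $ i $ j"
    and "homotopy_jacobian m A q v v0 \<mu> $ i $ Inr () = homotopy_dmu m A q v v0 \<mu> $ i"
  unfolding homotopy_jacobian_def homotopy_dv_def homotopy_dmu_def
  by (simp_all add: jacobian_bordered[OF differentiable_homotopy])

lemma matrix_inv_mult_vec:
  fixes M :: "'a::field^'n^'n"
  assumes "det M \<noteq> 0"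
  shows "M *v (matrix_inv M *v b) = b"
proof -
  have "\<exists>M'. M ** M' = mat 1 \<and> M' ** M = mat 1"
    using assms by (simp add: invertible_det_nz[symmetric] invertible_def)
  then have "M ** matrix_inv M = mat 1"
    unfolding matrix_inv_def by (rule someI2_ex) simp
  then show ?thesis
    by (simp add: matrix_vector_mul_assoc)
qed

theorem theorem3p5:
  fixes A :: "'n::finite list \<Rightarrow> real" and q :: "real^'n" and v0 :: "real^'n four" and m :: nat
  assumes "m \<ge> 2"
    and "A \<in> tensors m"
    and "v0 \<in> F1"
    and "smooth_curve_from (v0, 1) (homotopy_curve m A q v0)"
  shows "sgn (det (homotopy_jacobian m A q v0 v0 1
                    \<frown> (vec (predictor m A q v0) :: real^('n four + unit)^unit))) < 0"
proof -
  define M where "M = homotopy_dv m A q v0 v0 1"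
  define b where "b = homotopy_dmu m A q v0 v0 1"
  define s where "s = matrix_inv M *v b"
  define n where "n = norm (s \<frown> (vec (-1) :: real^unit))"
  define N where "N = homotopy_jacobian m A q v0 v0 1
    \<frown> (vec (predictor m A q v0) :: real^('n four + unit)^unit)"

  obtain x w z1 z2 where v0: "v0 = x \<frown> w \<frown> z1 \<frown> z2"
    and "\<And>i. 0 < x $ i" "\<And>i. 0 < w $ i"
    using \<open>v0 \<in> F1\<close> by (auto simp: F1_def)
  then have "0 < det M"
    by (simp add: M_def det_homotopy_dv_at_one prod_pos)

  have "(s \<frown> (vec (-1) :: real^unit)) $ Inr () \<noteq> 0"
    by simp
  then have "0 < n"
    unfolding n_def zero_less_norm_iff by (metis zero_index)

  have block: "(\<chi> i j. N $ Inl i $ Inl j) = M" and col: "(\<chi> i. N $ Inl i $ Inr ()) = b"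
    by (simp_all add: N_def M_def b_def homotopy_jacobian_columns vec_eq_iff)
  have "M *v s = b"
    using \<open>0 < det M\<close> by (simp add: s_def matrix_inv_mult_vec)
  then have "det N = det M * (N $ Inr () $ Inr () - (\<Sum>j\<in>UNIV. N $ Inr () $ Inl j * s $ j))"
    using det_bordered[of N s] by (simp add: block col)
  also have "\<dots> = det M * (- (1 + (\<Sum>j\<in>UNIV. (s $ j)\<^sup>2)) / n)"
    by (simp add: N_def predictor_def Let_def M_def[symmetric] b_def[symmetric] s_def[symmetric]
        n_def[symmetric] sum_divide_distrib power2_eq_square diff_divide_distrib)
  also have "\<dots> < 0"
    using \<open>0 < det M\<close> \<open>0 < n\<close> sum_nonneg[of UNIV "\<lambda>j. (s $ j)\<^sup>2"]
    by (intro mult_pos_neg divide_neg_pos) simp_all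
  finally show ?thesis
    by (simp add: N_def)
qed

end
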